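(* Let $l^2=\{x=(x_1,x_2,\ldots)\in\mathbb{R}^{\mathbb{N}}:\sum_{k=1}^\infty x_k^2<\infty\}$ with the norm $\|x\|=\big(\sum_{k=1}^\infty x_k^2\big)^{1/2}$, and let $|||x|||=\big(\sum_{k=1}^\infty \frac{x_k^2}{k}\big)^{1/2}$ for $x\in l^2$. Then $$F(x)=\exp\Big(-\frac{1}{|||x|||^{2}}\Big)\cdot x$$ is a $C^1$ map from $(l^2,\|\cdot\|)$ to $(l^2,\|\cdot\|)$ with a unique critical point, located at the origin.
   Context: Convention: $\frac{1}{0}=\infty$ and $\exp(-\infty)=0$, so $F(0)=0$. Let $X,Y$ be real Banach spaces and $F:X\to Y$ a map that is Fréchet differentiable at $x\in X$ with derivative $J_F(x)\in B(X,Y)$, where $B(X,Y)$ is the space of bounded linear operators from $X$ to $Y$. The point $x$ is a regular point of $F$ if $J_F(x)$ has an inverse in $B(Y,X)$, and a critical point of $F$ otherwise. $F$ is $C^1$ if it is Fréchet differentiable everywhere and $x\mapsto J_F(x)$ is continuous from $X$ to $B(X,Y)$ with the operator norm. *)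

theory Defs
  imports "HOL-Analysis.Analysis"
begin

typedef l2 = "{x :: nat \<Rightarrow> real. summable (\<lambda>k. (x k)\<^sup>2)}"
  morphisms coord Abs_l2
  by (rule exI[of _ "\<lambda>_. 0"]) simp

setup_lifting type_definition_l2

text \<open>Coordinates are indexed from 0: \<open>coord x k\<close> is the entry \<open>x\<^sub>k\<^sub>+\<^sub>1\<close> of the sequence
  \<open>(x\<^sub>1, x\<^sub>2, \<dots>)\<close>.\<close>

lemma l2_eqI: "(\<And>k. coord x k = coord y k) \<Longrightarrow> x = y"
  by (metis coord_inject ext)

lemma summable_coord_sq: "summable (\<lambda>k. (coord x k)\<^sup>2)"
  using coord[of x] by simp

lemma summable_prod_of_squares:
  fixes f g :: "nat \<Rightarrow> real"
  assumes "summable (\<lambda>k. (f k)\<^sup>2)" "summable (\<lambda>k. (g k)\<^sup>2)"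
  shows "summable (\<lambda>k. f k * g k)"
proof (rule summable_comparison_test')
  show "summable (\<lambda>k. (f k)\<^sup>2 + (g k)\<^sup>2)" by (intro summable_add assms)
  fix k :: nat
  have "0 \<le> (\<bar>f k\<bar> - \<bar>g k\<bar>)\<^sup>2" by simp
  then have "2 * (\<bar>f k\<bar> * \<bar>g k\<bar>) \<le> (f k)\<^sup>2 + (g k)\<^sup>2"
    by (simp add: power2_diff mult.assoc)
  moreover have "0 \<le> \<bar>f k\<bar> * \<bar>g k\<bar>" by simp
  ultimately show "norm (f k * g k) \<le> (f k)\<^sup>2 + (g k)\<^sup>2"
    unfolding real_norm_def abs_mult by linarith
qed

lemma summable_sq_add:
  fixes f g :: "nat \<Rightarrow> real"
  assumes "summable (\<lambda>k. (f k)\<^sup>2)" "summable (\<lambda>k. (g k)\<^sup>2)"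
  shows "summable (\<lambda>k. (f k + g k)\<^sup>2)"
proof -
  have "summable (\<lambda>k. (f k)\<^sup>2 + (g k)\<^sup>2 + 2 * (f k * g k))"
    by (intro summable_add summable_mult summable_prod_of_squares assms)
  then show ?thesis by (simp add: power2_sum mult.assoc)
qed

lemma summable_sq_diff:
  fixes f g :: "nat \<Rightarrow> real"
  assumes "summable (\<lambda>k. (f k)\<^sup>2)" "summable (\<lambda>k. (g k)\<^sup>2)"
  shows "summable (\<lambda>k. (f k - g k)\<^sup>2)"
  using summable_sq_add[of f "\<lambda>k. - g k"] assms by simp

instantiation l2 :: real_vector
begin

lift_definition zero_l2 :: l2 is "\<lambda>_. 0" by simp
lift_definition plus_l2 :: "l2 \<Rightarrow> l2 \<Rightarrow> l2" is "\<lambda>x y k. x k + y k"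
  by (rule summable_sq_add)
lift_definition minus_l2 :: "l2 \<Rightarrow> l2 \<Rightarrow> l2" is "\<lambda>x y k. x k - y k"
  by (rule summable_sq_diff)
lift_definition uminus_l2 :: "l2 \<Rightarrow> l2" is "\<lambda>x k. - x k" by simp
lift_definition scaleR_l2 :: "real \<Rightarrow> l2 \<Rightarrow> l2" is "\<lambda>r x k. r * x k"
  by (simp add: power_mult_distrib summable_mult)

instance
  by standard (transfer; simp add: algebra_simps fun_eq_iff)+

end

lemma coord_simps [simp]:
  "coord 0 k = 0"
  "coord (x + y) k = coord x k + coord y k"
  "coord (x - y) k = coord x k - coord y k"
  "coord (- x) k = - coord x k"
  "coord (r *\<^sub>R x) k = r * coord x k"
  by (transfer; simp)+

instantiation l2 :: real_inner
begin

definition inner_l2 :: "l2 \<Rightarrow> l2 \<Rightarrow> real"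
  where "inner_l2 x y = (\<Sum>k. coord x k * coord y k)"
definition norm_l2 :: "l2 \<Rightarrow> real"
  where "norm_l2 x = sqrt (\<Sum>k. (coord x k)\<^sup>2)"
definition dist_l2 :: "l2 \<Rightarrow> l2 \<Rightarrow> real"
  where "dist_l2 x y = norm (x - y)"
definition sgn_l2 :: "l2 \<Rightarrow> l2"
  where "sgn_l2 x = x /\<^sub>R norm x"
definition uniformity_l2 :: "(l2 \<times> l2) filter"
  where "uniformity_l2 = (INF e\<in>{0<..}. principal {(x, y). dist x y < e})"
definition open_l2 :: "l2 set \<Rightarrow> bool"
  where "open_l2 U = (\<forall>x\<in>U. eventually (\<lambda>(x', y). x' = x \<longrightarrow> y \<in> U) uniformity)"

instance
proof
  fix x y z :: l2 and r :: real and U :: "l2 set"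
  note smm = summable_prod_of_squares[OF summable_coord_sq summable_coord_sq]
  show "dist x y = norm (x - y)" by (rule dist_l2_def)
  show "sgn x = x /\<^sub>R norm x" by (rule sgn_l2_def)
  show "uniformity = (INF e\<in>{0<..}. principal {(x :: l2, y). dist x y < e})"
    by (rule uniformity_l2_def)
  show "open U = (\<forall>x\<in>U. eventually (\<lambda>(x', y). x' = x \<longrightarrow> y \<in> U) uniformity)"
    by (rule open_l2_def)
  show "inner x y = inner y x" by (simp add: inner_l2_def mult.commute)
  show "inner (x + y) z = inner x z + inner y z"
    by (simp add: inner_l2_def distrib_right suminf_add[OF smm smm])
  show "inner (r *\<^sub>R x) y = r * inner x y"
    by (simp add: inner_l2_def mult.assoc suminf_mult[OF smm])
  show "0 \<le> inner x x"
    using smm[of x x] by (simp add: inner_l2_def suminf_nonneg)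
  have "inner x x = 0 \<longleftrightarrow> (\<forall>k. coord x k = 0)"
    using suminf_eq_zero_iff[OF smm[of x x]] by (simp add: inner_l2_def)
  also have "\<dots> \<longleftrightarrow> x = 0" by (metis coord_simps(1) l2_eqI)
  finally show "inner x x = 0 \<longleftrightarrow> x = 0" .
  show "norm x = sqrt (inner x x)" by (simp add: norm_l2_def inner_l2_def power2_eq_square)
qed

end

lemma abs_coord_le_norm: "\<bar>coord x k\<bar> \<le> norm x"
proof -
  have "(\<Sum>j\<in>{k}. (coord x j)\<^sup>2) \<le> (\<Sum>j. (coord x j)\<^sup>2)"
    by (rule sum_le_suminf[OF summable_coord_sq]) auto
  then show ?thesis unfolding norm_l2_def by (intro real_le_rsqrt) simp
qed

lemma partial_sum_le_norm: "(\<Sum>j<m. (coord x j)\<^sup>2) \<le> (norm x)\<^sup>2"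
proof -
  have "(\<Sum>j<m. (coord x j)\<^sup>2) \<le> (\<Sum>j. (coord x j)\<^sup>2)"
    by (rule sum_le_suminf[OF summable_coord_sq]) auto
  also have "\<dots> = (norm x)\<^sup>2"
    by (simp add: norm_l2_def suminf_nonneg[OF summable_coord_sq])
  finally show ?thesis .
qed

instance l2 :: banach
proof
  fix X :: "nat \<Rightarrow> l2"
  assume X: "Cauchy X"
  have "\<exists>l. (\<lambda>n. coord (X n) k) \<longlonglongrightarrow> l" for k
  proof -
    have "Cauchy (\<lambda>n. coord (X n) k)"
    proof (rule metric_CauchyI)
      fix e :: real assume "0 < e"
      then obtain M where M: "\<And>m n. m \<ge> M \<Longrightarrow> n \<ge> M \<Longrightarrow> dist (X m) (X n) < e"
        using metric_CauchyD[OF X] by blast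
      have "dist (coord (X m) k) (coord (X n) k) < e" if "m \<ge> M" "n \<ge> M" for m n
        using M[OF that] abs_coord_le_norm[of "X m - X n" k]
        by (simp add: dist_norm)
      then show "\<exists>M. \<forall>m\<ge>M. \<forall>n\<ge>M. dist (coord (X m) k) (coord (X n) k) < e" by blast
    qed
    then show ?thesis by (simp add: Cauchy_convergent_iff convergent_def)
  qed
  then obtain l where l: "\<And>k. (\<lambda>n. coord (X n) k) \<longlonglongrightarrow> l k" by metis
  have tail: "\<exists>M. \<forall>n\<ge>M. \<forall>m. (\<Sum>j<m. (coord (X n) j - l j)\<^sup>2) \<le> e\<^sup>2" if "0 < e" for e
  proof -
    obtain M where M: "\<And>m n. m \<ge> M \<Longrightarrow> n \<ge> M \<Longrightarrow> dist (X m) (X n) < e"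
      using metric_CauchyD[OF X \<open>0 < e\<close>] by blast
    have "(\<Sum>j<m. (coord (X n) j - l j)\<^sup>2) \<le> e\<^sup>2" if "n \<ge> M" for n m
    proof (rule LIMSEQ_le_const2)
      show "(\<lambda>p. \<Sum>j<m. (coord (X n) j - coord (X p) j)\<^sup>2)
              \<longlonglongrightarrow> (\<Sum>j<m. (coord (X n) j - l j)\<^sup>2)"
        by (intro tendsto_intros l)
      have "(\<Sum>j<m. (coord (X n) j - coord (X p) j)\<^sup>2) \<le> e\<^sup>2" if "p \<ge> M" for p
      proof -
        have "(\<Sum>j<m. (coord (X n) j - coord (X p) j)\<^sup>2) \<le> (norm (X n - X p))\<^sup>2"
          using partial_sum_le_norm[of "X n - X p" m] by simp
        also have "\<dots> \<le> e\<^sup>2"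
          using M[OF \<open>n \<ge> M\<close> \<open>p \<ge> M\<close>] by (intro power_mono) (simp_all add: dist_norm)
        finally show ?thesis .
      qed
      then show "\<exists>N. \<forall>p\<ge>N. (\<Sum>j<m. (coord (X n) j - coord (X p) j)\<^sup>2) \<le> e\<^sup>2" by blast
    qed
    then show ?thesis by blast
  qed
  have summ: "summable (\<lambda>j. (f j)\<^sup>2)" and bound: "(\<Sum>j. (f j)\<^sup>2) \<le> e\<^sup>2"
    if "\<forall>m. (\<Sum>j<m. (f j)\<^sup>2) \<le> e\<^sup>2" for f :: "nat \<Rightarrow> real" and e
  proof -
    show s: "summable (\<lambda>j. (f j)\<^sup>2)"
    proof (rule summableI_nonneg_bounded)
      show "0 \<le> (f n)\<^sup>2" for n by simp
      show "(\<Sum>j<n. (f j)\<^sup>2) \<le> e\<^sup>2" for n using that by blast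
    qed
    show "(\<Sum>j. (f j)\<^sup>2) \<le> e\<^sup>2"
      using that by (intro suminf_le_const[OF s]) auto
  qed
  obtain M1 where M1: "\<forall>m. (\<Sum>j<m. (coord (X M1) j - l j)\<^sup>2) \<le> 1\<^sup>2"
    using tail[of 1] by force
  have "summable (\<lambda>j. (coord (X M1) j - (coord (X M1) j - l j))\<^sup>2)"
    by (rule summable_sq_diff[OF summable_coord_sq summ[OF M1]])
  then have "summable (\<lambda>j. (l j)\<^sup>2)" by simp
  then have L: "coord (Abs_l2 l) = l" by (simp add: Abs_l2_inverse)
  have "X \<longlonglongrightarrow> Abs_l2 l"
  proof (rule metric_LIMSEQ_I)
    fix r :: real assume "0 < r"
    then obtain M where M: "\<forall>n\<ge>M. \<forall>m. (\<Sum>j<m. (coord (X n) j - l j)\<^sup>2) \<le> (r / 2)\<^sup>2"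
      using tail[of "r / 2"] by auto
    have "dist (X n) (Abs_l2 l) < r" if "n \<ge> M" for n
    proof -
      have "dist (X n) (Abs_l2 l) = sqrt (\<Sum>j. (coord (X n) j - l j)\<^sup>2)"
        by (simp add: dist_norm norm_l2_def L)
      also have "\<dots> \<le> r / 2"
        using bound[of "\<lambda>j. coord (X n) j - l j" "r / 2"] M that \<open>0 < r\<close>
        by (intro real_le_lsqrt) auto
      finally show ?thesis using \<open>0 < r\<close> by simp
    qed
    then show "\<exists>N. \<forall>n\<ge>N. dist (X n) (Abs_l2 l) < r" by blast
  qed
  then show "convergent X" by (auto simp: convergent_def)
qed

definition jacobian :: "('a::banach \<Rightarrow> 'b::banach) \<Rightarrow> 'a \<Rightarrow> 'a \<Rightarrow>\<^sub>L 'b"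
  where "jacobian F x = Blinfun (frechet_derivative F (at x))"

definition has_bounded_inverse :: "('a::banach \<Rightarrow>\<^sub>L 'b::banach) \<Rightarrow> bool"
  where "has_bounded_inverse T \<longleftrightarrow>
    (\<exists>S :: 'b \<Rightarrow>\<^sub>L 'a. S o\<^sub>L T = id_blinfun \<and> T o\<^sub>L S = id_blinfun)"

definition regular_point :: "('a::banach \<Rightarrow> 'b::banach) \<Rightarrow> 'a \<Rightarrow> bool"
  where "regular_point F x \<longleftrightarrow>
    F differentiable (at x) \<and> has_bounded_inverse (jacobian F x)"

definition critical_point :: "('a::banach \<Rightarrow> 'b::banach) \<Rightarrow> 'a \<Rightarrow> bool"
  where "critical_point F x \<longleftrightarrow> F differentiable (at x) \<and> \<not> regular_point F x"

definition C1_map :: "('a::banach \<Rightarrow> 'b::banach) \<Rightarrow> bool"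
  where "C1_map F \<longleftrightarrow>
    (\<forall>x. F differentiable (at x)) \<and> continuous_on UNIV (jacobian F)"

text \<open>\<open>Blinfun\<close> and \<open>frechet_derivative\<close> are total functions; at points of differentiability
  \<open>jacobian\<close> is the Frechet derivative.\<close>

lemma has_derivative_jacobian:
  assumes "F differentiable (at x)"
  shows "(F has_derivative blinfun_apply (jacobian F x)) (at x)"
proof -
  have *: "(F has_derivative frechet_derivative F (at x)) (at x)"
    using assms by (simp add: frechet_derivative_works)
  then have "bounded_linear (frechet_derivative F (at x))"
    by (rule has_derivative_bounded_linear)
  then show ?thesis using * by (simp add: jacobian_def bounded_linear_Blinfun_apply)
qed

definition wnorm :: "l2 \<Rightarrow> real"
  where "wnorm x = sqrt (\<Sum>k. (coord x k)\<^sup>2 / real (Suc k))"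

lemma summable_wnorm: "summable (\<lambda>k. (coord x k)\<^sup>2 / real (Suc k))"
proof (rule summable_comparison_test'[OF summable_coord_sq[of x]])
  fix k :: nat
  have "(coord x k)\<^sup>2 / real (Suc k) \<le> (coord x k)\<^sup>2 / 1"
    by (rule divide_left_mono) auto
  then show "norm ((coord x k)\<^sup>2 / real (Suc k)) \<le> (coord x k)\<^sup>2" by simp
qed

text \<open>\<open>exp (- 1 / t)\<close> for \<open>t \<ge> 0\<close> under the convention \<open>1 / 0 = \<infinity>\<close>, \<open>exp (- \<infinity>) = 0\<close>; the case
  distinction is needed because \<open>1 / 0 = 0\<close> in HOL.\<close>

definition exp_neg_inverse :: "real \<Rightarrow> real"
  where "exp_neg_inverse t = (if t = 0 then 0 else exp (- (1 / t)))"

definition F_map :: "l2 \<Rightarrow> l2"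
  where "F_map x = exp_neg_inverse ((wnorm x)\<^sup>2) *\<^sub>R x"

end

theory Submission
  imports Defs "HOL-Real_Asymp.Real_Asymp"
begin

text \<open>Writing \<open>q x = |||x|||\<^sup>2 = \<langle>W x, x\<rangle>\<close> with the diagonal operator \<open>W\<close> and \<open>g t = exp (- 1 / t)\<close>,
  the derivative of \<open>F\<close> at \<open>x\<close> is the rank-one perturbation \<open>v \<mapsto> g (q x) v + 2 g' (q x) \<langle>W x, v\<rangle> x\<close>
  of a multiple of the identity, where \<open>g' t = g t / t\<^sup>2\<close>. It depends continuously on \<open>x\<close> because \<open>g\<close>
  is \<open>C\<^sup>1\<close> on \<open>[0, \<infinity>)\<close>, and it vanishes at the origin. For \<open>x \<noteq> 0\<close> it is \<open>g (q x)\<close> times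
  \<open>v \<mapsto> v + (2 / q\<^sup>2) \<langle>W x, v\<rangle> x\<close>, which the Sherman--Morrison formula inverts since
  \<open>1 + (2 / q\<^sup>2) \<langle>W x, x\<rangle> = 1 + 2 / q \<noteq> 0\<close>.\<close>

lift_definition weight_op :: "l2 \<Rightarrow> l2" is "\<lambda>x k. x k / real (Suc k)"
proof -
  fix f :: "nat \<Rightarrow> real"
  assume f: "summable (\<lambda>k. (f k)\<^sup>2)"
  show "summable (\<lambda>k. (f k / real (Suc k))\<^sup>2)"
  proof (rule summable_comparison_test'[OF f])
    fix k
    have "(f k)\<^sup>2 / (real (Suc k))\<^sup>2 \<le> (f k)\<^sup>2 / 1"
      by (rule divide_left_mono) auto
    then show "norm ((f k / real (Suc k))\<^sup>2) \<le> (f k)\<^sup>2"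
      by (simp add: power_divide)
  qed
qed

lemma coord_weight_op [simp]: "coord (weight_op x) k = coord x k / real (Suc k)"
  by transfer simp

lemma norm_weight_op_le: "norm (weight_op x) \<le> norm x"
  unfolding norm_l2_def
proof (intro real_sqrt_le_mono suminf_le summable_coord_sq)
  fix k
  have "(coord x k)\<^sup>2 / (real (Suc k))\<^sup>2 \<le> (coord x k)\<^sup>2 / 1"
    by (rule divide_left_mono) auto
  then show "(coord (weight_op x) k)\<^sup>2 \<le> (coord x k)\<^sup>2"
    by (simp add: power_divide)
qed

lemma bounded_linear_weight_op: "bounded_linear weight_op"
proof (rule bounded_linear_intro[where K = 1])
  show "weight_op (x + y) = weight_op x + weight_op y" for x y
    by (rule l2_eqI) (simp add: add_divide_distrib)
  show "weight_op (r *\<^sub>R x) = r *\<^sub>R weight_op x" for r x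
    by (rule l2_eqI) simp
  show "norm (weight_op x) \<le> norm x * 1" for x
    using norm_weight_op_le by simp
qed

text \<open>Self-adjointness of the diagonal operator lets the two product-rule terms of the
  derivative of \<open>inner (weight_op x) x\<close> merge into one with factor 2.\<close>

lemma inner_weight_op_commute: "inner x (weight_op y) = inner (weight_op x) y"
  by (simp add: inner_l2_def)

lemma wnorm_sq: "(wnorm x)\<^sup>2 = inner (weight_op x) x"
proof -
  have "(wnorm x)\<^sup>2 = (\<Sum>k. (coord x k)\<^sup>2 / real (Suc k))"
    unfolding wnorm_def
    by (intro real_sqrt_pow2 suminf_nonneg summable_wnorm) simp
  then show ?thesis
    by (simp add: inner_l2_def power2_eq_square)
qed

lemma wnorm_sq_eq_0_iff: "(wnorm x)\<^sup>2 = 0 \<longleftrightarrow> x = 0"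
proof -
  have "wnorm x = 0 \<longleftrightarrow> (\<forall>k. coord x k = 0)"
    using suminf_eq_zero_iff[OF summable_wnorm[of x]] by (simp add: wnorm_def del: of_nat_Suc)
  also have "\<dots> \<longleftrightarrow> x = 0"
    by (metis coord_simps(1) l2_eqI)
  finally show ?thesis by simp
qed

lemma has_derivative_wnorm_sq:
  "((\<lambda>x. (wnorm x)\<^sup>2) has_derivative (\<lambda>v. 2 * inner (weight_op x) v)) (at x)"
proof -
  have "((\<lambda>x. inner (weight_op x) x) has_derivative
      (\<lambda>v. inner (weight_op x) v + inner (weight_op v) x)) (at x)"
    by (intro derivative_intros bounded_linear.has_derivative[OF bounded_linear_weight_op])
  moreover have "inner (weight_op v) x = inner (weight_op x) v" for v
    by (metis inner_commute inner_weight_op_commute)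
  ultimately show ?thesis
    by (simp add: wnorm_sq)
qed

lemma continuous_on_wnorm_sq: "continuous_on UNIV (\<lambda>x. (wnorm x)\<^sup>2)"
  using has_derivative_continuous[OF has_derivative_wnorm_sq]
  by (simp add: continuous_on_eq_continuous_at)

text \<open>At \<open>t = 0\<close> the value is \<open>0 / 0 = 0\<close>, which is the right derivative there.\<close>

definition exp_neg_inverse_deriv :: "real \<Rightarrow> real"
  where "exp_neg_inverse_deriv t = exp_neg_inverse t / t\<^sup>2"

lemma exp_neg_inverse_0 [simp]: "exp_neg_inverse 0 = 0"
  by (simp add: exp_neg_inverse_def)

lemma exp_neg_inverse_deriv_0 [simp]: "exp_neg_inverse_deriv 0 = 0"
  by (simp add: exp_neg_inverse_deriv_def)

text \<open>The derivative is taken within \<open>{0..}\<close> because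
  \<open>exp_neg_inverse\<close> blows up as its argument tends to 0 from the left. At 0 the
  difference quotient is \<open>exp (- (1 / s)) / s\<close>, which tends to 0 from the
  right.\<close>

lemma exp_neg_inverse_DERIV:
  assumes "0 \<le> t"
  shows "(exp_neg_inverse has_real_derivative exp_neg_inverse_deriv t) (at t within {0..})"
proof (cases "t = 0")
  case True
  have "((\<lambda>s::real. exp (- (1 / s)) / s) \<longlongrightarrow> 0) (at_right 0)"
    by real_asymp
  then have "((\<lambda>s. exp_neg_inverse s / s) \<longlongrightarrow> 0) (at_right 0)"
    by (rule Lim_transform_eventually)
      (auto simp: exp_neg_inverse_def intro!: eventually_at_rightI[of 0 1])
  then show ?thesis
    by (simp add: True has_field_derivative_iff at_within_Ici_at_right)
next
  case False
  with assms have t: "0 < t" by simp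
  have "((\<lambda>s. exp (- (1 / s))) has_real_derivative exp_neg_inverse_deriv t) (at t)"
    using t by (auto intro!: derivative_eq_intros
        simp: exp_neg_inverse_deriv_def exp_neg_inverse_def power2_eq_square)
  then have "(exp_neg_inverse has_real_derivative exp_neg_inverse_deriv t) (at t)"
    by (rule has_field_derivative_transform_within_open[of _ _ _ "{0<..}"])
      (use t in \<open>auto simp: exp_neg_inverse_def\<close>)
  then show ?thesis
    by (rule has_field_derivative_at_within)
qed

lemma continuous_on_exp_neg_inverse: "continuous_on {0..} exp_neg_inverse"
  using exp_neg_inverse_DERIV by (intro DERIV_continuous_on) auto

lemma continuous_on_exp_neg_inverse_deriv: "continuous_on {0..} exp_neg_inverse_deriv"
  unfolding continuous_on_def
proof
  fix t :: real
  assume "t \<in> {0..}"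
  show "(exp_neg_inverse_deriv \<longlongrightarrow> exp_neg_inverse_deriv t) (at t within {0..})"
  proof (cases "t = 0")
    case True
    \<comment> \<open>Exponential decay beats the pole of order 2; away from 0 a quotient of
      continuous functions suffices.\<close>
    have "((\<lambda>s::real. exp (- (1 / s)) / s\<^sup>2) \<longlongrightarrow> 0) (at_right 0)"
      by real_asymp
    then have "(exp_neg_inverse_deriv \<longlongrightarrow> 0) (at_right 0)"
      by (rule Lim_transform_eventually)
        (auto simp: exp_neg_inverse_deriv_def exp_neg_inverse_def intro!: eventually_at_rightI[of 0 1])
    then show ?thesis
      by (simp add: True at_within_Ici_at_right)
  next
    case False
    have "(exp_neg_inverse \<longlongrightarrow> exp_neg_inverse t) (at t within {0..})"
      using continuous_on_exp_neg_inverse \<open>t \<in> {0..}\<close> by (simp add: continuous_on_def)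
    then show ?thesis
      unfolding exp_neg_inverse_deriv_def using False by (intro tendsto_intros) auto
  qed
qed

lemma has_bounded_inverse_scaled_id_plus_rank_one:
  fixes \<phi> :: "'a::banach \<Rightarrow>\<^sub>L real"
  assumes "a \<noteq> 0" and "a + \<phi> x \<noteq> 0"
  shows "has_bounded_inverse (a *\<^sub>R id_blinfun + (blinfun_scaleR_left x o\<^sub>L \<phi>))"
proof -
  \<comment> \<open>Applying \<open>\<phi>\<close> to
    \<open>a *\<^sub>R v + \<phi> v *\<^sub>R x = w\<close> gives
    \<open>\<phi> v = \<phi> w / (a + \<phi> x)\<close>; solving for \<open>v\<close> then yields
    \<open>S w\<close>.\<close>
  define S where
    "S = (1 / a) *\<^sub>R (id_blinfun - (1 / (a + \<phi> x)) *\<^sub>R (blinfun_scaleR_left x o\<^sub>L \<phi>))"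
  have "S (a *\<^sub>R v + \<phi> v *\<^sub>R x) = v"
    and "a *\<^sub>R S v + \<phi> (S v) *\<^sub>R x = v" for v
  proof -
    define b where "b = a + \<phi> x"
    have x: "\<phi> x = b - a" and b: "b \<noteq> 0" using assms by (simp_all add: b_def)
    have S: "S w = (1 / a) *\<^sub>R w - (\<phi> w / (a * b)) *\<^sub>R x" for w
      by (simp add: S_def b_def blinfun.bilinear_simps scaleR_diff_right)
    have "S (a *\<^sub>R v + \<phi> v *\<^sub>R x)
        = v + (\<phi> v / a - \<phi> v / b - \<phi> v * \<phi> x / (a * b)) *\<^sub>R x"
      using assms by (simp add: S blinfun.bilinear_simps algebra_simps add_divide_distrib)
    also have "\<phi> v / a - \<phi> v / b - \<phi> v * \<phi> x / (a * b) = 0"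
      using assms b by (simp add: x field_simps)
    finally show "S (a *\<^sub>R v + \<phi> v *\<^sub>R x) = v" by simp
    have "a *\<^sub>R S v + \<phi> (S v) *\<^sub>R x
        = v + (\<phi> v / a - \<phi> v / (a * b) * \<phi> x - \<phi> v / b) *\<^sub>R x"
      using assms by (simp add: S blinfun.bilinear_simps algebra_simps)
    also have "\<phi> v / a - \<phi> v / (a * b) * \<phi> x - \<phi> v / b = 0"
      using assms b by (simp add: x field_simps)
    finally show "a *\<^sub>R S v + \<phi> (S v) *\<^sub>R x = v" by simp
  qed
  then show ?thesis
    unfolding has_bounded_inverse_def
    by (intro exI[of _ S] conjI blinfun_eqI) (simp_all add: blinfun.bilinear_simps)
qed

text \<open>A left inverse of 0 would force every vector to be 0. The nonzero \<open>x\<close>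
  excludes the trivial space, on which 0 is the identity.\<close>

lemma not_has_bounded_inverse_0:
  assumes "(x :: 'a::banach) \<noteq> 0"
  shows "\<not> has_bounded_inverse (0 :: 'a \<Rightarrow>\<^sub>L 'b::banach)"
proof
  assume "has_bounded_inverse (0 :: 'a \<Rightarrow>\<^sub>L 'b)"
  then obtain S :: "'b \<Rightarrow>\<^sub>L 'a" where "S o\<^sub>L 0 = id_blinfun"
    by (auto simp: has_bounded_inverse_def)
  then have "(S o\<^sub>L 0) x = id_blinfun x" by simp
  with assms show False by (simp add: blinfun.zero_right)
qed

text \<open>Composing bounded operators makes continuity in the operator norm compositional, and
  gives the form scaled identity plus rank one.\<close>

definition F_deriv :: "l2 \<Rightarrow> l2 \<Rightarrow>\<^sub>L l2"
  where "F_deriv x = exp_neg_inverse ((wnorm x)\<^sup>2) *\<^sub>R id_blinfun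
    + (blinfun_scaleR_left x o\<^sub>L
        ((2 * exp_neg_inverse_deriv ((wnorm x)\<^sup>2)) *\<^sub>R blinfun_inner_right (weight_op x)))"

lemma F_map_has_derivative: "(F_map has_derivative F_deriv x) (at x)"
proof -
  have "(exp_neg_inverse has_derivative (*) (exp_neg_inverse_deriv ((wnorm x)\<^sup>2)))
      (at ((wnorm x)\<^sup>2) within {0..})"
    using exp_neg_inverse_DERIV[of "(wnorm x)\<^sup>2"] by (simp add: has_field_derivative_def)
  \<comment> \<open>The chain rule asks for the outer derivative only within the range of the inner
    map, which lies in \<open>{0..}\<close>, so the one-sided derivative is enough.\<close>
  then have "(exp_neg_inverse has_derivative (*) (exp_neg_inverse_deriv ((wnorm x)\<^sup>2)))
      (at ((wnorm x)\<^sup>2) within range (\<lambda>x. (wnorm x)\<^sup>2))"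
    by (rule has_derivative_subset) auto
  from has_derivative_in_compose[OF has_derivative_wnorm_sq this]
  have "((\<lambda>x. exp_neg_inverse ((wnorm x)\<^sup>2)) has_derivative
      (\<lambda>v. exp_neg_inverse_deriv ((wnorm x)\<^sup>2) * (2 * inner (weight_op x) v))) (at x)" .
  from has_derivative_scaleR[OF this has_derivative_ident]
  show ?thesis
    unfolding F_map_def [abs_def]
    by (rule has_derivative_eq_rhs)
      (simp add: F_deriv_def fun_eq_iff blinfun.bilinear_simps inner_commute mult_ac)
qed

lemma F_map_differentiable: "F_map differentiable (at x)"
  using F_map_has_derivative by (rule differentiableI)

lemma jacobian_F_map: "jacobian F_map x = F_deriv x"
  unfolding jacobian_def
  by (metis F_map_has_derivative frechet_derivative_at blinfun_apply_inverse)

lemma continuous_on_F_deriv: "continuous_on UNIV F_deriv"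
proof -
  have "continuous_on UNIV (\<lambda>x. f ((wnorm x)\<^sup>2))" if "continuous_on {0..} f" for f :: "real \<Rightarrow> real"
    by (rule continuous_on_compose2[OF that continuous_on_wnorm_sq]) auto
  note c = this[OF continuous_on_exp_neg_inverse] this[OF continuous_on_exp_neg_inverse_deriv]
  show ?thesis
    unfolding F_deriv_def [abs_def]
    by (intro continuous_intros c bounded_bilinear.continuous_on[OF bounded_bilinear_blinfun_compose]
        bounded_linear.continuous_on[OF bounded_linear_blinfun_scaleR_left]
        bounded_linear.continuous_on[OF bounded_linear_blinfun_inner_right]
        bounded_linear.continuous_on[OF bounded_linear_weight_op])
qed

lemma critical_point_F_map_iff: "critical_point F_map x \<longleftrightarrow> x = 0"
proof (cases "x = 0")
  case True
  \<comment> \<open>The first unit vector shows that \<open>l2\<close> is nontrivial, so the zero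
    derivative at the origin is not invertible.\<close>
  have "summable (\<lambda>k::nat. (if k = 0 then 1 else 0 :: real)\<^sup>2)"
    by (rule summable_finite[of "{0}"]) auto
  then have "coord (Abs_l2 (\<lambda>k. if k = 0 then 1 else 0)) 0 = 1"
    by (subst Abs_l2_inverse) simp_all
  then have "Abs_l2 (\<lambda>k. if k = 0 then 1 else 0) \<noteq> 0"
    by (metis coord_simps(1) zero_neq_one)
  moreover have "F_deriv 0 = 0"
    using wnorm_sq_eq_0_iff[of 0] by (simp add: F_deriv_def blinfun_eqI blinfun.bilinear_simps)
  ultimately show ?thesis
    by (simp add: True critical_point_def regular_point_def F_map_differentiable jacobian_F_map
        not_has_bounded_inverse_0)
next
  case False
  define q where "q = (wnorm x)\<^sup>2"
  have q: "0 < q"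
    using False wnorm_sq_eq_0_iff[of x] by (simp add: q_def)
  then have g: "0 < exp_neg_inverse q"
    by (simp add: exp_neg_inverse_def)
  \<comment> \<open>This is the Sherman--Morrison denominator \<open>a + \<phi> x\<close>, since
    \<open>inner (weight_op x) x = q\<close>.\<close>
  have "0 < exp_neg_inverse q + 2 * exp_neg_inverse_deriv q * q"
    using q g by (simp add: exp_neg_inverse_deriv_def add_pos_pos)
  then have "has_bounded_inverse (F_deriv x)"
    unfolding F_deriv_def using g
    by (intro has_bounded_inverse_scaled_id_plus_rank_one)
      (simp_all add: blinfun.bilinear_simps flip: q_def wnorm_sq)
  with False show ?thesis
    by (simp add: critical_point_def regular_point_def F_map_differentiable jacobian_F_map)
qed

theorem theorem3p1:
  shows "C1_map F_map \<and> (\<exists>!x. critical_point F_map x) \<and> critical_point F_map 0"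
  using continuous_on_F_deriv
  by (simp add: C1_map_def F_map_differentiable jacobian_F_map [abs_def] critical_point_F_map_iff)

end
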